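(* Let $G^c$ be a finite simple graph. If the eLehot algorithm, run on input $G^c$, produces an output multigraph $G'$, then $G'$ is a root graph of $G^c$, i.e. the line graph $L(G')$ is isomorphic to $G^c$.
   Context: For a (loopless, possibly multi-) graph $G'$, its line graph $L(G')$ has one vertex for each edge of $G'$, two vertices being adjacent iff the corresponding edges share an end vertex (in particular parallel edges give adjacent vertices). Two distinct vertices of a simple graph are true twins if they are adjacent and have equal closed neighbourhoods; this relation (with equality) is an equivalence relation whose classes are cliques. The eLehot algorithm on input $G^c$: Step 1: contract every edge of $G^c$ whose end vertices are true twins, obtaining the simple graph $H$ whose vertices are the true-twin classes of $G^c$ (two classes adjacent iff their vertices are adjacent in $G^c$), each vertex of $H$ labelled by the size (multiplicity) of its class. Step 2: run Lehot's algorithm on $H$; this either reports that $H$ is not the line graph of any simple graph, or outputs a simple graph $H'$ with $L(H')=H$ together with the correspondence between vertices of $H$ and edges of $H'$. Step 3: if $H'$ is output, replace each edge of $H'$ by as many parallel edges as the label of the corresponding vertex of $H$; the resulting multigraph $G'$ is the output. If Lehot's algorithm gives no root graph, eLehot has no output. *)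

theory Defs
  imports Main
begin

record 'v sgraph =
  verts :: "'v set"
  edges :: "'v set set"

definition finite_simple_graph :: "'v sgraph \<Rightarrow> bool" where
  "finite_simple_graph G \<longleftrightarrow>
     finite (verts G) \<and> (\<forall>e \<in> edges G. e \<subseteq> verts G \<and> card e = 2)"

definition adjacent :: "'v sgraph \<Rightarrow> 'v \<Rightarrow> 'v \<Rightarrow> bool" where
  "adjacent G u v \<longleftrightarrow> {u, v} \<in> edges G"

definition graph_iso :: "'v sgraph \<Rightarrow> 'w sgraph \<Rightarrow> ('v \<Rightarrow> 'w) \<Rightarrow> bool" where
  "graph_iso G H f \<longleftrightarrow> bij_betw f (verts G) (verts H) \<and>
     (\<forall>u \<in> verts G. \<forall>v \<in> verts G. adjacent G u v \<longleftrightarrow> adjacent H (f u) (f v))"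

definition isomorphic :: "'v sgraph \<Rightarrow> 'w sgraph \<Rightarrow> bool" where
  "isomorphic G H \<longleftrightarrow> (\<exists>f. graph_iso G H f)"

text \<open>In a multigraph the edges are names; distinct names with the same end set are
  parallel edges.\<close>

record ('v, 'e) mgraph =
  mverts :: "'v set"
  medges :: "'e set"
  ends :: "'e \<Rightarrow> 'v set"

definition finite_loopless_mgraph :: "('v, 'e) mgraph \<Rightarrow> bool" where
  "finite_loopless_mgraph M \<longleftrightarrow> finite (mverts M) \<and> finite (medges M) \<and>
     (\<forall>e \<in> medges M. ends M e \<subseteq> mverts M \<and> card (ends M e) = 2)"

definition mgraph_of :: "'v sgraph \<Rightarrow> ('v, 'v set) mgraph" where
  "mgraph_of G = \<lparr>mverts = verts G, medges = edges G, ends = (\<lambda>e. e)\<rparr>"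

definition line_graph :: "('v, 'e) mgraph \<Rightarrow> 'e sgraph" where
  "line_graph M =
     \<lparr>verts = medges M,
      edges = {{e, f} | e f. e \<in> medges M \<and> f \<in> medges M \<and> e \<noteq> f \<and>
                             ends M e \<inter> ends M f \<noteq> {}}\<rparr>"

definition root_graph :: "('v, 'e) mgraph \<Rightarrow> 'a sgraph \<Rightarrow> bool" where
  "root_graph M G \<longleftrightarrow> finite_loopless_mgraph M \<and> isomorphic (line_graph M) G"

definition closed_nbhd :: "'v sgraph \<Rightarrow> 'v \<Rightarrow> 'v set" where
  "closed_nbhd G v = insert v {u \<in> verts G. adjacent G u v}"

definition true_twins :: "'v sgraph \<Rightarrow> 'v \<Rightarrow> 'v \<Rightarrow> bool" where
  "true_twins G u v \<longleftrightarrow>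
     u \<noteq> v \<and> adjacent G u v \<and> closed_nbhd G u = closed_nbhd G v"

definition twin_rel :: "'v sgraph \<Rightarrow> ('v \<times> 'v) set" where
  "twin_rel G = {(u, v). u \<in> verts G \<and> v \<in> verts G \<and> (u = v \<or> true_twins G u v)}"

text \<open>The simple graph obtained by contracting all edges joining true twins: a vertex
  of the contracted graph is the set of original vertices merged into it, so the label
  of a vertex is its cardinality.\<close>

definition contract_twins :: "'v sgraph \<Rightarrow> 'v set sgraph" where
  "contract_twins G =
     \<lparr>verts = verts G // twin_rel G,
      edges = {{A, B} | A B. A \<in> verts G // twin_rel G \<and> B \<in> verts G // twin_rel G \<and>
                             A \<noteq> B \<and> (\<exists>a \<in> A. \<exists>b \<in> B. adjacent G a b)}\<rparr>"

definition multiplicity :: "'v set \<Rightarrow> nat" where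
  "multiplicity A = card A"

definition expand_edges :: "'v sgraph \<Rightarrow> ('v set \<Rightarrow> nat) \<Rightarrow> ('v, 'v set \<times> nat) mgraph" where
  "expand_edges H m =
     \<lparr>mverts = verts H, medges = {(e, i). e \<in> edges H \<and> i < m e}, ends = fst\<rparr>"

text \<open>Lehot's algorithm enters through its input/output contract. On success the result
  is a simple graph together with the correspondence sending each of its edges to a
  vertex of the input graph; \<open>None\<close> means that the input is reported not to be the line
  graph of a simple graph. Every finite graph has a copy with vertices in \<open>nat\<close>, so
  taking root graphs over \<open>nat\<close> loses no generality.\<close>

type_synonym 'v lehot = "'v sgraph \<Rightarrow> (nat sgraph \<times> (nat set \<Rightarrow> 'v)) option"

definition lehot_correct :: "'v lehot \<Rightarrow> bool" where
  "lehot_correct lehot \<longleftrightarrow> (\<forall>H. finite_simple_graph H \<longrightarrow>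
     (case lehot H of
        None \<Rightarrow> \<not> (\<exists>H' :: nat sgraph. finite_simple_graph H' \<and>
                        isomorphic (line_graph (mgraph_of H')) H)
      | Some (H', \<psi>) \<Rightarrow> finite_simple_graph H' \<and>
                        graph_iso (line_graph (mgraph_of H')) H \<psi>))"

lemma ex_lehot_correct: "\<exists>lehot :: 'v lehot. lehot_correct lehot"
proof -
  have "\<exists>r :: (nat sgraph \<times> (nat set \<Rightarrow> 'v)) option. case r of
        None \<Rightarrow> \<not> (\<exists>H' :: nat sgraph. finite_simple_graph H' \<and>
                        isomorphic (line_graph (mgraph_of H')) H)
      | Some (H', \<psi>) \<Rightarrow> finite_simple_graph H' \<and>
                        graph_iso (line_graph (mgraph_of H')) H \<psi>"
    for H :: "'v sgraph"
  proof (cases "\<exists>(H' :: nat sgraph) \<psi>. finite_simple_graph H' \<and>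
                   graph_iso (line_graph (mgraph_of H')) H \<psi>")
    case True
    then obtain H' :: "nat sgraph" and \<psi> where
      "finite_simple_graph H' \<and> graph_iso (line_graph (mgraph_of H')) H \<psi>" by blast
    then show ?thesis by (rule_tac x = "Some (H', \<psi>)" in exI) simp
  next
    case False
    then show ?thesis by (rule_tac x = None in exI) (auto simp: isomorphic_def)
  qed
  then show ?thesis
    unfolding lehot_correct_def by (intro choice allI) (rule ex_forward, assumption, rule impI)
qed

definition eLehot :: "'v set lehot \<Rightarrow> 'v sgraph \<Rightarrow> (nat, nat set \<times> nat) mgraph option" where
  "eLehot lehot G =
     (case lehot (contract_twins G) of
        None \<Rightarrow> None
      | Some (H', \<psi>) \<Rightarrow> Some (expand_edges H' (\<lambda>e. multiplicity (\<psi> e))))"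

end

(* Vertices of a twin class are pairwise adjacent and have the same neighbours outside the class.
   Likewise, parallel edges of the output pairwise meet and have the same end set. Hence numbering
   the vertices of every class turns Lehot's correspondence between edges of H' and classes into a
   bijection between the parallel edges and the vertices of the input, and this bijection preserves
   adjacency both inside a class and between two classes. *)

theory Submission
  imports Defs
begin

lemma adjacent_commute: "adjacent G u v \<longleftrightarrow> adjacent G v u"
  by (simp add: adjacent_def insert_commute)

lemma adjacent_irrefl: "finite_simple_graph G \<Longrightarrow> \<not> adjacent G v v"
  by (auto simp: adjacent_def finite_simple_graph_def)

lemma adjacent_in_verts:
  assumes "finite_simple_graph G" "adjacent G u v"
  shows "u \<in> verts G" "v \<in> verts G"
  using assms by (auto simp: adjacent_def finite_simple_graph_def)

lemma finite_edges: "finite_simple_graph G \<Longrightarrow> finite (edges G)"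
  by (rule finite_subset[of _ "Pow (verts G)"]) (auto simp: finite_simple_graph_def)

lemma mem_closed_nbhd:
  "finite_simple_graph G \<Longrightarrow> u \<in> closed_nbhd G v \<longleftrightarrow> u = v \<or> adjacent G u v"
  by (auto simp: closed_nbhd_def dest: adjacent_in_verts)

text \<open>Adjacency of true twins is implied, as each vertex lies in its own closed neighbourhood.\<close>

lemma twin_rel_iff:
  assumes "finite_simple_graph G"
  shows "(u, v) \<in> twin_rel G \<longleftrightarrow>
    u \<in> verts G \<and> v \<in> verts G \<and> closed_nbhd G u = closed_nbhd G v"
  using mem_closed_nbhd[OF assms, of u u] mem_closed_nbhd[OF assms, of u v]
  by (auto simp: twin_rel_def true_twins_def)

text \<open>Being twins or equal amounts to having equal values of \<open>closed_nbhd G\<close>, and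
  the kernel of a function is an equivalence.\<close>

lemma equiv_twin_rel: "finite_simple_graph G \<Longrightarrow> equiv (verts G) (twin_rel G)"
  by (rule equivI) (auto simp: refl_on_def sym_def trans_def twin_rel_iff)

lemma twin_class_closed_nbhd:
  assumes "finite_simple_graph G" "A \<in> verts G // twin_rel G" "a \<in> A" "a' \<in> A"
  shows "closed_nbhd G a = closed_nbhd G a'"
  using quotient_eq_iff[OF equiv_twin_rel[OF assms(1)] assms(2,2,3,4)]
  by (simp add: twin_rel_iff[OF assms(1)])

text \<open>Since \<open>a\<close> lies in its own closed neighbourhood, it lies in that of
  \<open>a'\<close>, so the two are equal or adjacent; loops are excluded.\<close>

lemma adjacent_twin_class:
  assumes "finite_simple_graph G" "A \<in> verts G // twin_rel G" "a \<in> A" "a' \<in> A"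
  shows "adjacent G a a' \<longleftrightarrow> a \<noteq> a'"
  using twin_class_closed_nbhd[OF assms] mem_closed_nbhd[OF assms(1)] adjacent_irrefl[OF assms(1)]
  by blast

text \<open>A vertex outside the class differs from \<open>a\<close> and \<open>a'\<close>, so for
  it membership in their common closed neighbourhood is the same as adjacency.\<close>

lemma adjacent_twin_class_outside:
  assumes "finite_simple_graph G" "A \<in> verts G // twin_rel G" "a \<in> A" "a' \<in> A" "b \<notin> A"
  shows "adjacent G a b \<longleftrightarrow> adjacent G a' b"
proof -
  have "b \<in> closed_nbhd G a \<longleftrightarrow> b \<in> closed_nbhd G a'"
    using twin_class_closed_nbhd[OF assms(1-4)] by simp
  then show ?thesis
    using assms(3-5) by (auto simp: mem_closed_nbhd[OF assms(1)] adjacent_commute)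
qed

text \<open>This makes the contract of Lehot's algorithm applicable to the contracted graph.\<close>

lemma finite_simple_graph_contract_twins:
  assumes "finite_simple_graph G"
  shows "finite_simple_graph (contract_twins G)"
proof -
  have "finite (verts G)"
    using assms by (simp add: finite_simple_graph_def)
  moreover have "twin_rel G \<subseteq> verts G \<times> verts G"
    by (auto simp: twin_rel_def)
  ultimately have "finite (verts G // twin_rel G)"
    by (rule finite_quotient)
  moreover have "e \<subseteq> verts G // twin_rel G \<and> card e = 2"
    if e: "e \<in> edges (contract_twins G)" for e
  proof -
    obtain A B where "e = {A, B}" "A \<in> verts G // twin_rel G" "B \<in> verts G // twin_rel G" "A \<noteq> B"
      using e unfolding contract_twins_def sgraph.simps mem_Collect_eq by metis
    then show ?thesis by simp
  qed
  ultimately show ?thesis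
    by (simp add: finite_simple_graph_def contract_twins_def)
qed

text \<open>Contraction only asks for some adjacent pair of representatives. Replacing one end at a
  time by a twin shows that all pairs agree, so any chosen pair decides.\<close>

lemma adjacent_contract_twins:
  assumes G: "finite_simple_graph G"
    and A: "A \<in> verts G // twin_rel G" and B: "B \<in> verts G // twin_rel G"
    and ne: "A \<noteq> B" and a: "a \<in> A" and b: "b \<in> B"
  shows "adjacent (contract_twins G) A B \<longleftrightarrow> adjacent G a b"
proof -
  \<comment> \<open>Disjointness puts each representative outside the other class, as exchanging
    twins requires.\<close>
  have disj: "A \<inter> B = {}"
    using quotient_disj[OF equiv_twin_rel[OF G] A B] ne by simp
  have "adjacent G x y \<longleftrightarrow> adjacent G a b" if "x \<in> A" "y \<in> B" for x y
  proof -
    have "adjacent G x y \<longleftrightarrow> adjacent G a y"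
      using adjacent_twin_class_outside[OF G A that(1) a] that(2) disj by blast
    also have "\<dots> \<longleftrightarrow> adjacent G a b"
      using adjacent_twin_class_outside[OF G B that(2) b, of a] a disj
      by (auto simp: adjacent_commute)
    finally show ?thesis .
  qed
  then have "(\<exists>x\<in>A. \<exists>y\<in>B. adjacent G x y) \<longleftrightarrow> adjacent G a b"
    using a b by blast
  moreover have "adjacent (contract_twins G) A B \<longleftrightarrow> (\<exists>x\<in>A. \<exists>y\<in>B. adjacent G x y)"
  proof
    assume "adjacent (contract_twins G) A B"
    then obtain A' B' where "{A, B} = {A', B'}" "\<exists>x\<in>A'. \<exists>y\<in>B'. adjacent G x y"
      unfolding adjacent_def[of _ A B] contract_twins_def sgraph.simps mem_Collect_eq
      by metis
    \<comment> \<open>The unordered pair may list the classes in either order; symmetry of adjacency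
      covers the swapped one.\<close>
    then show "\<exists>x\<in>A. \<exists>y\<in>B. adjacent G x y"
      unfolding doubleton_eq_iff using adjacent_commute[of G] by blast
  next
    assume "\<exists>x\<in>A. \<exists>y\<in>B. adjacent G x y"
    then show "adjacent (contract_twins G) A B"
      unfolding adjacent_def[of _ A B] contract_twins_def sgraph.simps mem_Collect_eq
      using A B ne by blast
  qed
  ultimately show ?thesis by simp
qed

lemma adjacent_line_graph:
  "adjacent (line_graph M) e f \<longleftrightarrow>
    e \<in> medges M \<and> f \<in> medges M \<and> e \<noteq> f \<and> ends M e \<inter> ends M f \<noteq> {}"
  by (auto simp: adjacent_def line_graph_def doubleton_eq_iff)

lemma finite_loopless_expand_edges:
  assumes "finite_simple_graph H"
  shows "finite_loopless_mgraph (expand_edges H m)"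
proof -
  \<comment> \<open>As a dependent sum of finite initial segments over a finite edge set, the set of
    copies is finite.\<close>
  have "{(e, i). e \<in> edges H \<and> i < m e} = (SIGMA e:edges H. {..<m e})"
    by auto
  then show ?thesis
    using assms finite_edges[OF assms]
    by (auto simp: finite_loopless_mgraph_def expand_edges_def finite_simple_graph_def)
qed

lemma isomorphic_line_graph_expand_edges:
  assumes G: "finite_simple_graph G" and H: "finite_simple_graph H"
    and iso: "graph_iso (line_graph (mgraph_of H)) (contract_twins G) \<psi>"
  shows "isomorphic (line_graph (expand_edges H (\<lambda>e. multiplicity (\<psi> e)))) G"
proof -
  let ?Q = "verts G // twin_rel G"
  let ?M = "expand_edges H (\<lambda>e. multiplicity (\<psi> e))"
  have bij: "bij_betw \<psi> (edges H) ?Q"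
    using iso by (simp add: graph_iso_def line_graph_def mgraph_of_def contract_twins_def)
  have \<psi>: "\<psi> e \<in> ?Q" if "e \<in> edges H" for e
    using bij_betwE[OF bij] that by blast
  have \<psi>_eq: "\<psi> e = \<psi> e' \<longleftrightarrow> e = e'" if "e \<in> edges H" "e' \<in> edges H" for e e'
    using bij that by (auto simp: bij_betw_def inj_on_eq_iff)
  have adj: "e \<inter> e' \<noteq> {} \<longleftrightarrow> adjacent (contract_twins G) (\<psi> e) (\<psi> e')"
    if "e \<in> edges H" "e' \<in> edges H" "e \<noteq> e'" for e e'
  proof -
    have "adjacent (line_graph (mgraph_of H)) e e' \<longleftrightarrow> adjacent (contract_twins G) (\<psi> e) (\<psi> e')"
      using iso that by (simp add: graph_iso_def line_graph_def mgraph_of_def)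
    then show ?thesis
      using that by (simp add: adjacent_line_graph mgraph_of_def)
  qed
  have fin: "finite A" if "A \<in> ?Q" for A
    using in_quotient_imp_subset[OF equiv_twin_rel[OF G] that] G
    by (auto simp: finite_simple_graph_def intro: finite_subset)
  \<comment> \<open>The condition on \<open>A\<close> stands inside the existential, so that choice
    yields one total function \<open>g\<close> numbering every class.\<close>
  have "\<forall>A. \<exists>g. A \<in> ?Q \<longrightarrow> bij_betw g {..<card A} A"
    using fin ex_bij_betw_nat_finite by (metis lessThan_atLeast0)
  then obtain g where g: "\<And>A. A \<in> ?Q \<Longrightarrow> bij_betw (g A) {..<card A} A"
    by metis
  have medges: "(e, i) \<in> medges ?M \<longleftrightarrow> e \<in> edges H \<and> i < card (\<psi> e)" for e i
    by (simp add: expand_edges_def multiplicity_def)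
  have ends: "ends ?M = fst"
    by (simp add: expand_edges_def)
  \<comment> \<open>Copy \<open>i\<close> of the edge \<open>e\<close> goes to vertex number
    \<open>i\<close> of the class \<open>\<psi> e\<close>. The copies of \<open>e\<close> are
    exactly as many as the vertices of that class.\<close>
  define F where "F = (\<lambda>(e, i). g (\<psi> e) i)"
  have F_in: "F (e, i) \<in> \<psi> e" if "(e, i) \<in> medges ?M" for e i
    using bij_betwE[OF g[OF \<psi>]] that by (auto simp: medges F_def)
  have F_eq: "F (e, i) = F (e, j) \<longleftrightarrow> i = j"
    if "(e, i) \<in> medges ?M" "(e, j) \<in> medges ?M" for e i j
    using g[OF \<psi>, of e] that by (auto simp: medges F_def bij_betw_def inj_on_eq_iff)
  have "bij_betw F (medges ?M) (verts G)"
    unfolding bij_betw_def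
  proof (intro conjI inj_onI subset_antisym subsetI)
    fix p q assume p: "p \<in> medges ?M" and q: "q \<in> medges ?M" and eq: "F p = F q"
    obtain e i e' j where pq: "p = (e, i)" "q = (e', j)" by fastforce
    have e: "e \<in> edges H" "e' \<in> edges H"
      using p q by (auto simp: pq medges)
    \<comment> \<open>A common image lies in both classes, so they coincide and injectivity of
      \<open>\<psi>\<close> gives the same edge of \<open>H\<close>; the numbering then separates
      the copies.\<close>
    have "F p \<in> \<psi> e \<inter> \<psi> e'"
      using F_in[of e i] F_in[of e' j] p q eq by (simp add: pq)
    then have "\<psi> e = \<psi> e'"
      using quotient_disj[OF equiv_twin_rel[OF G] \<psi>[OF e(1)] \<psi>[OF e(2)]] by blast
    then have "e = e'" by (simp add: \<psi>_eq e)
    then show "p = q" using F_eq p q eq by (auto simp: pq)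
  next
    fix v assume "v \<in> F ` medges ?M"
    then obtain e i where "(e, i) \<in> medges ?M" "v = F (e, i)" by fastforce
    then show "v \<in> verts G"
      using F_in \<psi> in_quotient_imp_subset[OF equiv_twin_rel[OF G]] by (fastforce simp: medges)
  next
    fix v assume "v \<in> verts G"
    then obtain A where A: "A \<in> ?Q" "v \<in> A"
      using Union_quotient[OF equiv_twin_rel[OF G]] by blast
    obtain e where e: "e \<in> edges H" "\<psi> e = A"
      using bij_betw_imp_surj_on[OF bij] A(1) by (metis imageE)
    obtain i where "i < card A" "g A i = v"
      using bij_betw_imp_surj_on[OF g[OF A(1)]] A(2) by (metis imageE lessThan_iff)
    then show "v \<in> F ` medges ?M"
      using e by (intro image_eqI[of _ _ "(e, i)"]) (auto simp: medges F_def)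
  qed
  moreover have "adjacent (line_graph ?M) p q \<longleftrightarrow> adjacent G (F p) (F q)"
    if p: "p \<in> medges ?M" and q: "q \<in> medges ?M" for p q
  proof -
    obtain e i e' j where pq: "p = (e, i)" "q = (e', j)" by fastforce
    have e: "e \<in> edges H" "e' \<in> edges H"
      using p q by (auto simp: pq medges)
    have F: "F p \<in> \<psi> e" "F q \<in> \<psi> e'"
      using F_in p q by (auto simp: pq)
    show ?thesis
    proof (cases "e = e'")
      case True
      \<comment> \<open>Copies of one edge meet only because their end set is nonempty; hence
        distinct copies are adjacent, matching the clique formed by a twin class.\<close>
      have "e \<noteq> {}"
        using H e(1) by (auto simp: finite_simple_graph_def)
      then have "adjacent (line_graph ?M) p q \<longleftrightarrow> F p \<noteq> F q"
        using p q F_eq True by (auto simp: adjacent_line_graph ends pq)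
      then show ?thesis
        using adjacent_twin_class[OF G \<psi>[OF e(1)]] F True by simp
    next
      case False
      \<comment> \<open>Here \<open>p\<close> and \<open>q\<close> are automatically distinct, and
        their ends are \<open>e\<close> and \<open>e'\<close>, so adjacency is that of the
        underlying edges of \<open>H\<close>, which \<open>\<psi>\<close> preserves.\<close>
      have "adjacent (line_graph ?M) p q \<longleftrightarrow> adjacent (contract_twins G) (\<psi> e) (\<psi> e')"
        using p q False adj[OF e False] by (simp add: adjacent_line_graph ends pq)
      also have "\<dots> \<longleftrightarrow> adjacent G (F p) (F q)"
        using adjacent_contract_twins[OF G \<psi>[OF e(1)] \<psi>[OF e(2)] _ F] \<psi>_eq[OF e] False by simp
      finally show ?thesis .
    qed
  qed
  ultimately have "graph_iso (line_graph ?M) G F"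
    by (simp add: graph_iso_def line_graph_def)
  then show ?thesis
    by (auto simp: isomorphic_def)
qed

theorem theorem2:
  fixes Gc :: "'a sgraph"
    and lehot :: "'a set lehot"
    and G' :: "(nat, nat set \<times> nat) mgraph"
  assumes "finite_simple_graph Gc"
    and "lehot_correct lehot"
    and "eLehot lehot Gc = Some G'"
  shows "root_graph G' Gc"
proof -
  obtain H \<psi> where run: "lehot (contract_twins Gc) = Some (H, \<psi>)"
    and G': "G' = expand_edges H (\<lambda>e. multiplicity (\<psi> e))"
    using assms(3) by (auto simp: eLehot_def split: option.splits)
  \<comment> \<open>The contract is instantiated at the contracted graph in unreduced form; the
    known result of the run then selects the success branch.\<close>
  have "case lehot (contract_twins Gc) of
        None \<Rightarrow> \<not> (\<exists>H' :: nat sgraph. finite_simple_graph H' \<and>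
                        isomorphic (line_graph (mgraph_of H')) (contract_twins Gc))
      | Some (H', \<psi>) \<Rightarrow> finite_simple_graph H' \<and>
                        graph_iso (line_graph (mgraph_of H')) (contract_twins Gc) \<psi>"
    using assms(2) finite_simple_graph_contract_twins[OF assms(1)]
    unfolding lehot_correct_def by blast
  then have "finite_simple_graph H"
    and "graph_iso (line_graph (mgraph_of H)) (contract_twins Gc) \<psi>"
    by (simp_all add: run)
  then show ?thesis
    unfolding root_graph_def G'
    using finite_loopless_expand_edges isomorphic_line_graph_expand_edges[OF assms(1)] by blast
qed

end
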